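(* Let $K$ be an algebraically closed field of characteristic $0$, and let $(p,q)$, $p,q\in K[x,y]$, be a Jacobian pair. Suppose $p$ has the form $p = x + g$ for some $g\in K[x,y]$ which is divisible by a non-constant homogeneous polynomial. Then $K[p,q]=K[x,y]$.
   Context: A pair $(p,q)$ of polynomials in $K[x,y]$ is a Jacobian pair if its $2\times 2$ Jacobian matrix of partial derivatives with respect to $x,y$ is invertible over $K[x,y]$. $K[p,q]$ denotes the $K$-subalgebra generated by $p$ and $q$. *)

theory Defs
  imports "HOL-Analysis.Analysis" "HOL-Computational_Algebra.Polynomial"
begin

text \<open>
  The polynomial ring \<open>K[x,y]\<close> is rendered as \<open>K[x][y]\<close>, i.e. the type \<open>'a poly poly\<close>: the inner
  variable is \<open>x\<close>, the outer one is \<open>y\<close>, and the coefficient of \<open>x\<^sup>i y\<^sup>j\<close> in \<open>f\<close> is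
  \<open>coeff (coeff f j) i\<close>.
\<close>

definition const_xy :: "'a::comm_ring_1 \<Rightarrow> 'a poly poly"
  where "const_xy c = [:[:c:]:]"

definition var_x :: "'a::comm_ring_1 poly poly"
  where "var_x = [:[:0, 1:]:]"

definition var_y :: "'a::comm_ring_1 poly poly"
  where "var_y = [:0, 1:]"

definition partial_x :: "'a::idom poly poly \<Rightarrow> 'a poly poly"
  where "partial_x f = map_poly pderiv f"

definition partial_y :: "'a::idom poly poly \<Rightarrow> 'a poly poly"
  where "partial_y f = pderiv f"

lemma coeff_partial_x:
  "coeff (coeff (partial_x f) j) i = of_nat (Suc i) * coeff (coeff f j) (Suc i)"
  by (simp add: partial_x_def coeff_map_poly coeff_pderiv)

lemma coeff_partial_y:
  "coeff (coeff (partial_y f) j) i = of_nat (Suc j) * coeff (coeff f (Suc j)) i"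
  by (simp only: partial_y_def coeff_pderiv of_nat_poly)
     (simp add: coeff_pCons)

lemma poly_xy_expansion:
  "f = (\<Sum>j\<le>degree f. \<Sum>i\<le>degree (coeff f j).
          const_xy (coeff (coeff f j) i) * var_x ^ i * var_y ^ j)"
proof -
  have inner: "(\<Sum>i\<le>degree p. const_xy (coeff p i) * var_x ^ i) = [:p:]" for p :: "'a poly"
  proof -
    have "const_xy (coeff p i) * var_x ^ i = [:monom (coeff p i) i:]" for i
      by (simp add: const_xy_def var_x_def poly_const_pow monom_altdef)
    then have "(\<Sum>i\<le>degree p. const_xy (coeff p i) * var_x ^ i)
        = (\<Sum>i\<le>degree p. [:monom (coeff p i) i:])" by simp
    also have "\<dots> = [:\<Sum>i\<le>degree p. monom (coeff p i) i:]"
      by (simp add: sum_to_poly)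
    finally show ?thesis by (simp add: poly_as_sum_of_monoms)
  qed
  have "(\<Sum>j\<le>degree f. \<Sum>i\<le>degree (coeff f j).
          const_xy (coeff (coeff f j) i) * var_x ^ i * var_y ^ j)
      = (\<Sum>j\<le>degree f. [:coeff f j:] * var_y ^ j)"
    by (simp only: inner flip: sum_distrib_right)
  also have "\<dots> = (\<Sum>j\<le>degree f. monom (coeff f j) j)"
    by (simp add: var_y_def monom_altdef)
  finally show ?thesis by (simp add: poly_as_sum_of_monoms)
qed

definition jacobian_matrix :: "'a::idom poly poly \<Rightarrow> 'a poly poly \<Rightarrow> 'a poly poly ^ 2 ^ 2"
  where "jacobian_matrix p q =
    vector [vector [partial_x p, partial_y p],
            vector [partial_x q, partial_y q]]"

definition jacobian_pair :: "'a::idom poly poly \<Rightarrow> 'a poly poly \<Rightarrow> bool"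
  where "jacobian_pair p q \<longleftrightarrow> invertible (jacobian_matrix p q)"

text \<open>As usual, the zero polynomial counts as homogeneous (of every degree).\<close>

definition homogeneous_xy :: "'a::comm_ring_1 poly poly \<Rightarrow> bool"
  where "homogeneous_xy h \<longleftrightarrow> (\<exists>d. \<forall>i j. coeff (coeff h j) i \<noteq> 0 \<longrightarrow> i + j = d)"

definition subalgebra_xy :: "'a::comm_ring_1 poly poly set \<Rightarrow> bool"
  where "subalgebra_xy A \<longleftrightarrow>
    1 \<in> A \<and>
    (\<forall>f\<in>A. \<forall>g\<in>A. f + g \<in> A) \<and>
    (\<forall>f\<in>A. \<forall>g\<in>A. f * g \<in> A) \<and>
    (\<forall>c. \<forall>f\<in>A. const_xy c * f \<in> A)"

definition generated_subalgebra :: "'a::comm_ring_1 poly poly set \<Rightarrow> 'a poly poly set"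
  where "generated_subalgebra S = subalgebra_xy hull S"

end

theory Submission
  imports Defs
begin

text \<open>
  Over an algebraically closed field the homogeneous polynomial \<open>h\<close> has a linear factor \<open>l\<close>, and on
  the line \<open>l = 0\<close> the polynomial \<open>p\<close> restricts to the coordinate \<open>x\<close>. If \<open>l = x\<close>, then \<open>p\<close> itself is
  divisible by \<open>l\<close>. Otherwise \<open>l = y - t x\<close>; with \<open>r(x) = q(x, t x)\<close> the polynomial \<open>q - r(p)\<close>
  vanishes on the line, and replacing \<open>q\<close> by it changes neither the Jacobian determinant nor the
  algebra \<open>K[p, q]\<close>. So it is enough to treat a Jacobian pair in which one component is divisible by
  a linear form, and after a linear change of coordinates that form is \<open>y\<close>.

  Let therefore \<open>(u, v)\<close> have a nonzero constant Jacobian determinant, and let \<open>y\<close> divide \<open>v\<close>. On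
  \<open>y = 0\<close> the determinant is \<open>\<partial>u/\<partial>x\<close> times the coefficient of \<open>y\<close> in \<open>v\<close>, so both factors are
  constants: \<open>u = c + a x + y (\<dots>)\<close> and \<open>v = b y + y\<^sup>2 (\<dots>)\<close> with \<open>a\<close> and \<open>b\<close> nonzero. Suppose that
  the Newton polygon of \<open>u\<close> has an edge from \<open>(1, 0)\<close>, or that of \<open>v\<close> has one from \<open>(0, 1)\<close>, leading
  vertically upwards or up and to the right. Take the flattest such edge, along which \<open>i\<close> grows by
  \<open>s \<ge> 0\<close> when \<open>j\<close> grows by one, and let \<open>P\<close> and \<open>Q\<close> be the far end points of the faces of \<open>u\<close> and
  \<open>v\<close> in this direction. Extremality makes \<open>P + Q\<close> a sum of support points in only one way, so
  \<open>det (P, Q)\<close> times two nonzero coefficients is a coefficient of \<open>x y\<close> times the Jacobian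
  determinant. A direct computation gives \<open>det (P, Q) > 0\<close>. Since \<open>x y\<close> times a constant has no other
  monomial, \<open>P + Q = (1, 1)\<close>: both faces are single points, a contradiction (lemma
  \<open>triangular_if_vanishing_on_axis\<close>). What remains is \<open>v = b y\<close> and \<open>u = a x + f(y)\<close>, a triangular
  automorphism.

  The polygon argument is carried out for coefficient families indexed by two exponents, because in
  this form it applies to both cases of \<open>l\<close>: exchanging \<open>x\<close> and \<open>y\<close> is a transposition of indices.
\<close>

section \<open>Jacobian coefficients and extreme points of supports\<close>

text \<open>
  If \<open>u\<close> and \<open>v\<close> are the coefficients of \<open>p\<close> and \<open>q\<close>, this is the coefficient of \<open>x\<^sup>m y\<^sup>n\<close> in \<open>x y\<close> times
  the Jacobian determinant. The factor \<open>x y\<close> replaces the partial derivatives by the Euler operators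
  \<open>x \<partial>/\<partial>x\<close> and \<open>y \<partial>/\<partial>y\<close>, which do not shift exponents.
\<close>

definition bracket_coeff :: "(nat \<Rightarrow> nat \<Rightarrow> 'a::comm_ring_1) \<Rightarrow> (nat \<Rightarrow> nat \<Rightarrow> 'a) \<Rightarrow> nat \<Rightarrow> nat \<Rightarrow> 'a"
  where "bracket_coeff u v m n =
    (\<Sum>(i, j) \<in> {..m} \<times> {..n}.
      (of_nat i * of_nat (n - j) - of_nat j * of_nat (m - i)) * (u i j * v (m - i) (n - j)))"

text \<open>
  Extreme points of the two supports satisfy the uniqueness hypothesis, and then no cancellation can
  occur: the coefficient is governed by the determinant of the two exponent vectors.
\<close>

lemma bracket_coeff_unique_summand:
  assumes unique: "\<And>i j i' j'. u i j \<noteq> 0 \<Longrightarrow> v i' j' \<noteq> 0 \<Longrightarrow>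
      i + i' = a + c \<Longrightarrow> j + j' = b + d \<Longrightarrow> i = a \<and> j = b"
  shows "bracket_coeff u v (a + c) (b + d)
      = (of_nat (a * d) - of_nat (b * c)) * (u a b * v c d)"
proof -
  have "bracket_coeff u v (a + c) (b + d) =
    (\<Sum>(i, j) \<in> {(a, b)}. (of_nat i * of_nat (b + d - j) - of_nat j * of_nat (a + c - i))
        * (u i j * v (a + c - i) (b + d - j)))"
    unfolding bracket_coeff_def
  proof (rule sum.mono_neutral_right)
    show "\<forall>z \<in> {..a + c} \<times> {..b + d} - {(a, b)}. (case z of (i, j) \<Rightarrow>
        (of_nat i * of_nat (b + d - j) - of_nat j * of_nat (a + c - i))
        * (u i j * v (a + c - i) (b + d - j))) = 0"
    proof
      fix z assume z: "z \<in> {..a + c} \<times> {..b + d} - {(a, b)}"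
      obtain i j where [simp]: "z = (i, j)" by fastforce
      have "u i j = 0 \<or> v (a + c - i) (b + d - j) = 0"
        using unique[of i j "a + c - i" "b + d - j"] z by auto
      then show "(case z of (i, j) \<Rightarrow>
        (of_nat i * of_nat (b + d - j) - of_nat j * of_nat (a + c - i))
        * (u i j * v (a + c - i) (b + d - j))) = 0" by auto
    qed
  qed auto
  then show ?thesis by simp
qed

text \<open>
  Exchanging the variables and exchanging the polynomials each change the sign of the Jacobian
  determinant; here both happen.
\<close>

lemma bracket_coeff_transpose:
  "bracket_coeff (\<lambda>i j. v j i) (\<lambda>i j. u j i) m n = bracket_coeff u v n m"
  unfolding bracket_coeff_def
  by (rule sum.reindex_bij_witness[where i = "\<lambda>(i, j). (m - j, n - i)"
      and j = "\<lambda>(i, j). (n - j, m - i)"])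
     (auto simp: algebra_simps)

lemma finite_argmax_snd:
  fixes S :: "(nat \<times> nat) set"
  assumes "finite S" "z \<in> S"
  obtains a b where "(a, b) \<in> S" "\<And>i j. (i, j) \<in> S \<Longrightarrow> j \<le> b"
proof -
  have "Max (snd ` S) \<in> snd ` S" using assms by (intro Max_in) auto
  then obtain a b where "(a, b) \<in> S" "b = Max (snd ` S)" by force
  moreover have "j \<le> Max (snd ` S)" if "(i, j) \<in> S" for i j
    using that assms(1) by (force intro: Max_ge)
  ultimately show thesis using that by blast
qed

text \<open>
  This is the Newton polygon argument. The condition on \<open>v i 0\<close> says that \<open>y\<close> divides the second polynomial,
  and it forces the points \<open>(1, 0)\<close> and \<open>(0, 1)\<close> into the two supports. Every other point that is to be
  excluded would give an edge starting at one of them; the flattest edge yields a pair of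
  extreme points with nonzero determinant and sum different from \<open>(1, 1)\<close>.
\<close>

lemma triangular_if_vanishing_on_axis:
  fixes u v :: "nat \<Rightarrow> nat \<Rightarrow> 'a::{idom, ring_char_0}"
  assumes fin_u: "finite {(i, j). u i j \<noteq> 0}" and fin_v: "finite {(i, j). v i j \<noteq> 0}"
    and axis: "\<And>i. v i 0 = 0"
    and bracket: "\<And>m n. bracket_coeff u v m n = (if m = 1 \<and> n = 1 then k else 0)"
    and "k \<noteq> 0"
  shows "u i j \<noteq> 0 \<Longrightarrow> i = 0 \<or> i = 1 \<and> j = 0"
    and "v i j \<noteq> 0 \<Longrightarrow> i = 0 \<and> j = 1"
    and "u 1 0 \<noteq> 0" and "v 0 1 \<noteq> 0"
proof -
  have v_pos: "0 < j" if "v i j \<noteq> 0" for i j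
    using that axis by (cases j) auto
  have sum_is_11: "a + c = 1 \<and> b + d = 1"
    if "u a b \<noteq> 0" "v c d \<noteq> 0" "a * d \<noteq> b * c"
      and "\<And>i j i' j'. u i j \<noteq> 0 \<Longrightarrow> v i' j' \<noteq> 0 \<Longrightarrow>
        i + i' = a + c \<Longrightarrow> j + j' = b + d \<Longrightarrow> i = a \<and> j = b" for a b c d
  proof (rule ccontr)
    assume "\<not> (a + c = 1 \<and> b + d = 1)"
    then have "bracket_coeff u v (a + c) (b + d) = 0" by (simp only: bracket if_False)
    moreover have "bracket_coeff u v (a + c) (b + d)
        = (of_nat (a * d) - of_nat (b * c)) * (u a b * v c d)"
      by (rule bracket_coeff_unique_summand) (use that(4) in blast)
    moreover have "(of_nat (a * d) :: 'a) \<noteq> of_nat (b * c)"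
      using that(3) of_nat_eq_iff by blast
    ultimately show False using that(1,2) by simp
  qed
  have "bracket_coeff u v 1 1 = u 1 0 * v 0 1"
    by (simp add: bracket_coeff_def atMost_Suc lessThan_Suc axis
        Sigma_Un_distrib1 flip: sum.cartesian_product)
  with bracket \<open>k \<noteq> 0\<close> show u10: "u 1 0 \<noteq> 0" and v01: "v 0 1 \<noteq> 0" by auto
  let ?U = "{(i, j). u i j \<noteq> 0}" and ?V = "{(i, j). v i j \<noteq> 0}"
  \<comment> \<open>The lowest rows, \<open>j = 0\<close> for \<open>u\<close> and \<open>j = 1\<close> for \<open>v\<close>, come first: the slopes below have
    denominators \<open>j\<close> and \<open>j - 1\<close>. Here the extreme points are the rightmost ones of these rows.\<close>
  have row: "(u i 0 \<noteq> 0 \<longrightarrow> i \<le> 1) \<and> (v i 1 \<noteq> 0 \<longrightarrow> i = 0)" for i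
  proof -
    have "finite {i. u i 0 \<noteq> 0}"
      by (rule finite_subset[of _ "fst ` ?U"]) (use fin_u in force)+
    moreover have "finite {i. v i 1 \<noteq> 0}"
      by (rule finite_subset[of _ "fst ` ?V"]) (use fin_v in force)+
    moreover define m n where "m = Max {i. u i 0 \<noteq> 0}" and "n = Max {i. v i 1 \<noteq> 0}"
    ultimately have m: "u m 0 \<noteq> 0" "\<And>i. u i 0 \<noteq> 0 \<Longrightarrow> i \<le> m"
      and n: "v n 1 \<noteq> 0" "\<And>i. v i 1 \<noteq> 0 \<Longrightarrow> i \<le> n"
      using u10 v01 Max_in[of "{i. u i 0 \<noteq> 0}"] Max_in[of "{i. v i 1 \<noteq> 0}"] by auto
    have "m + n = 1 \<and> 0 + 1 = (1::nat)"
    proof (rule sum_is_11)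
      show "m * 1 \<noteq> 0 * n" using m(2)[OF u10] by simp
    next
      fix i j i' j'
      assume A: "u i j \<noteq> 0" "v i' j' \<noteq> 0" "i + i' = m + n" "j + j' = 0 + 1"
      with v_pos[of i' j'] have "j = 0" "j' = 1" by auto
      with A m(2)[of i] n(2)[of i'] show "i = m \<and> j = 0" by auto
    qed (use m n in auto)
    with m(2)[OF u10] m n show ?thesis by force
  qed
  \<comment> \<open>Inverse slopes of the segments from \<open>(1, 0)\<close> and \<open>(0, 1)\<close> to the other support points. The
    value \<open>0\<close> is added so that the maximum is nonnegative even without rightward segments; the final
    step then needs no separate case.\<close>
  define slopes :: "real set" where "slopes = insert 0
    ((\<lambda>(i, j). (real i - 1) / real j) ` (?U \<inter> {z. 0 < snd z})
     \<union> (\<lambda>(i, j). real i / (real j - 1)) ` (?V \<inter> {z. 1 < snd z}))"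
  have fin_slopes: "finite slopes" unfolding slopes_def using fin_u fin_v by auto
  define s where "s = Max slopes"
  have "s \<ge> 0" unfolding s_def using fin_slopes by (intro Max_ge) (auto simp: slopes_def)
  have u_le: "real i \<le> 1 + s * real j" if "u i j \<noteq> 0" for i j
  proof (cases "j = 0")
    case True
    with that row[of i] show ?thesis by auto
  next
    case False
    with that have "(real i - 1) / real j \<in> slopes" unfolding slopes_def by force
    then have "(real i - 1) / real j \<le> s" unfolding s_def using fin_slopes by (intro Max_ge)
    with False show ?thesis by (simp add: field_simps)
  qed
  have v_le: "real i \<le> s * (real j - 1)" if "v i j \<noteq> 0" for i j
  proof (cases "j = 1")
    case True
    with that row[of i] show ?thesis by auto
  next
    case False
    with v_pos[OF that] have j: "1 < j" by simp
    with that have "real i / (real j - 1) \<in> slopes" unfolding slopes_def by force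
    then have "real i / (real j - 1) \<le> s" unfolding s_def using fin_slopes by (intro Max_ge)
    with j show ?thesis by (simp add: field_simps)
  qed
  \<comment> \<open>The bounds \<open>u_le\<close> and \<open>v_le\<close> are attained at \<open>(1, 0)\<close> and \<open>(0, 1)\<close>; the largest \<open>j\<close> among the
    points of equality picks the far end of each face.\<close>
  have "finite (?U \<inter> {(i, j). real i = 1 + s * real j})"
    and "(1, 0) \<in> ?U \<inter> {(i, j). real i = 1 + s * real j}"
    using fin_u u10 by auto
  then obtain a b where ab: "u a b \<noteq> 0" "real a = 1 + s * real b"
    and b_max: "\<And>i j. u i j \<noteq> 0 \<Longrightarrow> real i = 1 + s * real j \<Longrightarrow> j \<le> b"
    by (elim finite_argmax_snd) auto
  have "finite (?V \<inter> {(i, j). real i = s * (real j - 1)})"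
    and "(0, 1) \<in> ?V \<inter> {(i, j). real i = s * (real j - 1)}"
    using fin_v v01 by auto
  then obtain c d where cd: "v c d \<noteq> 0" "real c = s * (real d - 1)"
    and d_max: "\<And>i j. v i j \<noteq> 0 \<Longrightarrow> real i = s * (real j - 1) \<Longrightarrow> j \<le> d"
    by (elim finite_argmax_snd) auto
  have "a + c = 1 \<and> b + d = 1"
  proof (rule sum_is_11)
    have "real a * real d - real b * real c = real d + s * real b"
      by (simp add: ab(2) cd(2) algebra_simps)
    moreover have "real d + s * real b > 0"
      using v_pos[OF cd(1)] \<open>s \<ge> 0\<close> by (simp add: add_pos_nonneg)
    ultimately have "real (a * d) \<noteq> real (b * c)" by simp
    then show "a * d \<noteq> b * c" by metis
  next
    fix i j i' j'
    assume A: "u i j \<noteq> 0" "v i' j' \<noteq> 0" "i + i' = a + c" "j + j' = b + d"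
    \<comment> \<open>Both summands lie on their faces because the sum of the two slacks vanishes; the maximal
      choice of \<open>b\<close> and \<open>d\<close> then fixes the second exponents.\<close>
    have "real i + real i' = real a + real c" "real j + real j' = real b + real d"
      using A(3,4) by (metis of_nat_add)+
    then have "(1 + s * real j - real i) + (s * (real j' - 1) - real i') = 0"
      using ab(2) cd(2) by (simp add: algebra_simps) (metis distrib_left)
    with u_le[OF A(1)] v_le[OF A(2)]
    have eq: "real i = 1 + s * real j" "real i' = s * (real j' - 1)" by linarith+
    with b_max[OF A(1)] d_max[OF A(2)] A(4) have "j = b" by linarith
    with eq(1) ab(2) show "i = a \<and> j = b" by auto
  qed (fact ab cd)+
  with v_pos[OF cd(1)] have "b = 0" "d = 1" by auto
  have "s = 0"
  proof (rule ccontr)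
    assume "s \<noteq> 0"
    have "s \<in> slopes" unfolding s_def using fin_slopes by (intro Max_in) (auto simp: slopes_def)
    with \<open>s \<noteq> 0\<close> consider i j where "u i j \<noteq> 0" "0 < j" "s = (real i - 1) / real j"
      | i j where "v i j \<noteq> 0" "1 < j" "s = real i / (real j - 1)"
      unfolding slopes_def by auto
    then show False
    proof cases
      case 1
      with b_max[of i j] \<open>b = 0\<close> show False by (simp add: field_simps)
    next
      case 2
      with d_max[of i j] \<open>d = 1\<close> show False by (simp add: field_simps)
    qed
  qed
  show "i = 0 \<or> i = 1 \<and> j = 0" if "u i j \<noteq> 0"
    using u_le[OF that] b_max[OF that] \<open>s = 0\<close> \<open>b = 0\<close> by (cases "i = 0") auto
  show "i = 0 \<and> j = 1" if "v i j \<noteq> 0"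
    using v_le[OF that] d_max[OF that] v_pos[OF that] \<open>s = 0\<close> \<open>d = 1\<close> by auto
qed

section \<open>The Jacobian determinant\<close>

definition jacobian_det :: "'a::idom poly poly \<Rightarrow> 'a poly poly \<Rightarrow> 'a poly poly"
  where "jacobian_det p q = partial_x p * partial_y q - partial_y p * partial_x q"

text \<open>
  The determinant of an invertible matrix is a unit, and the units of \<open>K[x,y]\<close> are the nonzero
  constants.
\<close>

lemma jacobian_pair_imp_det_const:
  fixes p q :: "'a::field poly poly"
  assumes "jacobian_pair p q"
  obtains k where "k \<noteq> 0" "jacobian_det p q = const_xy k"
proof -
  obtain B where "jacobian_matrix p q ** B = mat 1"
    using assms by (auto simp: jacobian_pair_def invertible_def)
  then have "det (jacobian_matrix p q) * det B = 1"
    by (metis det_mul det_I)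
  moreover have "det (jacobian_matrix p q) = jacobian_det p q"
    by (simp add: det_2 jacobian_matrix_def jacobian_det_def vector_2)
  ultimately have "jacobian_det p q dvd 1" by (metis dvd_triv_left)
  then show thesis
    using that by (auto simp: is_unit_poly_iff const_xy_def dvd_field_iff)
qed

lemma partial_x_add: "partial_x (f + g) = partial_x f + partial_x g"
  by (rule poly_eqI) (simp add: partial_x_def coeff_map_poly pderiv_add)

lemma partial_x_mult: "partial_x (f * g) = partial_x f * g + f * partial_x g"
proof (rule poly_eqI)
  fix n
  have "coeff (partial_x (f * g)) n = (\<Sum>i\<le>n. pderiv (coeff f i * coeff g (n - i)))"
    by (simp add: partial_x_def coeff_map_poly coeff_mult higher_pderiv_sum[of 1, simplified])
  also have "\<dots> = (\<Sum>i\<le>n. pderiv (coeff f i) * coeff g (n - i) + coeff f i * pderiv (coeff g (n - i)))"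
    by (simp add: pderiv_mult algebra_simps)
  finally show "coeff (partial_x (f * g)) n = coeff (partial_x f * g + f * partial_x g) n"
    by (simp add: partial_x_def coeff_map_poly coeff_mult sum.distrib)
qed

lemma partial_y_add: "partial_y (f + g) = partial_y f + partial_y g"
  by (simp add: partial_y_def pderiv_add)

lemma partial_y_mult: "partial_y (f * g) = partial_y f * g + f * partial_y g"
  by (simp add: partial_y_def pderiv_mult algebra_simps)

lemma partial_const [simp]: "partial_x (const_xy c) = 0" "partial_y (const_xy c) = 0"
  by (rule poly_eqI, simp add: partial_x_def const_xy_def coeff_map_poly coeff_pCons split: nat.split)
     (simp add: partial_y_def const_xy_def)

lemma const_xy_0 [simp]: "const_xy 0 = 0"
  by (simp add: const_xy_def)

section \<open>Substituting an element into a univariate polynomial\<close>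

definition eval_at :: "'a::comm_ring_1 poly poly \<Rightarrow> 'a poly \<Rightarrow> 'a poly poly"
  where "eval_at f r = poly (map_poly const_xy r) f"

lemma eval_at_0 [simp]: "eval_at f 0 = 0"
  by (simp add: eval_at_def)

lemma eval_at_pCons [simp]: "eval_at f (pCons c r) = const_xy c + f * eval_at f r"
  by (cases "c = 0 \<and> r = 0") (auto simp: eval_at_def map_poly_pCons)

lemma jacobian_det_add_right: "jacobian_det p (f + g) = jacobian_det p f + jacobian_det p g"
  by (simp add: jacobian_det_def partial_x_add partial_y_add algebra_simps)

text \<open>
  Polynomials in \<open>p\<close> are algebraically dependent on \<open>p\<close>, so they can be subtracted from \<open>q\<close> freely.
\<close>

lemma jacobian_det_eval_at: "jacobian_det p (eval_at p r) = 0"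
proof (induction r)
  case 0
  then show ?case using partial_const[of "0::'a"] by (simp add: jacobian_det_def)
next
  case (pCons c r)
  then have "jacobian_det p (eval_at p (pCons c r)) = p * jacobian_det p (eval_at p r)"
    by (simp add: jacobian_det_def partial_x_add partial_y_add partial_x_mult partial_y_mult
        algebra_simps)
  with pCons show ?case by simp
qed

section \<open>Coefficients in two exponents\<close>

abbreviation coeff_xy :: "'a::zero poly poly \<Rightarrow> nat \<Rightarrow> nat \<Rightarrow> 'a"
  where "coeff_xy f i j \<equiv> coeff (coeff f j) i"

lemma finite_support_xy: "finite {(i, j). coeff_xy f i j \<noteq> 0}"
proof (rule finite_subset)
  show "{(i, j). coeff_xy f i j \<noteq> 0} \<subseteq> (\<lambda>(j, i). (i, j)) ` (SIGMA j:{..degree f}. {..degree (coeff f j)})"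
    by (force simp: image_iff intro: le_degree)
qed auto

lemma coeff_xy_mult:
  "coeff_xy (f * g) m n = (\<Sum>(i, j) \<in> {..m} \<times> {..n}. coeff_xy f i j * coeff_xy g (m - i) (n - j))"
  by (simp add: coeff_mult coeff_sum sum.swap[of _ "{..m}"] flip: sum.cartesian_product)

lemma coeff_var_x_partial_x: "coeff_xy (var_x * partial_x f) i j = of_nat i * coeff_xy f i j"
  by (cases i) (simp_all add: var_x_def coeff_partial_x del: of_nat_Suc)

lemma coeff_var_y_partial_y: "coeff_xy (var_y * partial_y f) i j = of_nat j * coeff_xy f i j"
  by (cases j) (simp_all add: var_y_def coeff_partial_y del: of_nat_Suc)

lemma bracket_coeff_jacobian:
  assumes "jacobian_det p q = const_xy k"
  shows "bracket_coeff (coeff_xy p) (coeff_xy q) m n = (if m = 1 \<and> n = 1 then k else 0)"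
proof -
  have "(var_x * partial_x p) * (var_y * partial_y q) - (var_y * partial_y p) * (var_x * partial_x q)
      = var_x * var_y * jacobian_det p q"
    by (simp add: jacobian_det_def algebra_simps)
  also have "\<dots> = [:0, [:0, k:]:]"
    by (simp add: assms var_x_def var_y_def const_xy_def)
  finally have "coeff_xy ((var_x * partial_x p) * (var_y * partial_y q)) m n
      - coeff_xy ((var_y * partial_y p) * (var_x * partial_x q)) m n = coeff_xy [:0, [:0, k:]:] m n"
    by (metis coeff_diff)
  moreover have "bracket_coeff (coeff_xy p) (coeff_xy q) m n
      = coeff_xy ((var_x * partial_x p) * (var_y * partial_y q)) m n
      - coeff_xy ((var_y * partial_y p) * (var_x * partial_x q)) m n"
    unfolding bracket_coeff_def coeff_xy_mult[of "var_x * _"] coeff_xy_mult[of "var_y * _"]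
      coeff_var_x_partial_x coeff_var_y_partial_y
    by (simp add: case_prod_unfold algebra_simps flip: sum_subtractf)
  ultimately show ?thesis by (auto simp: coeff_pCons split: nat.splits)
qed

section \<open>Subalgebras\<close>

lemma subalgebra_generated: "subalgebra_xy (generated_subalgebra S)"
  unfolding generated_subalgebra_def by (rule hull_in) (auto simp: subalgebra_xy_def)

lemma
  assumes "subalgebra_xy A"
  shows subalgebra_add: "f \<in> A \<Longrightarrow> g \<in> A \<Longrightarrow> f + g \<in> A"
    and subalgebra_mult: "f \<in> A \<Longrightarrow> g \<in> A \<Longrightarrow> f * g \<in> A"
    and subalgebra_const: "const_xy c \<in> A"
    and subalgebra_diff: "f \<in> A \<Longrightarrow> g \<in> A \<Longrightarrow> f - g \<in> A"
proof -
  show add: "f \<in> A \<Longrightarrow> g \<in> A \<Longrightarrow> f + g \<in> A" for f g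
    using assms by (simp add: subalgebra_xy_def)
  show mult: "f \<in> A \<Longrightarrow> g \<in> A \<Longrightarrow> f * g \<in> A"
    using assms by (simp add: subalgebra_xy_def)
  show const: "const_xy c \<in> A" for c
    using assms unfolding subalgebra_xy_def by (metis mult.right_neutral)
  show "f - g \<in> A" if "f \<in> A" "g \<in> A"
  proof -
    have "const_xy (-1) * g \<in> A" using assms that by (simp add: subalgebra_xy_def)
    moreover have "const_xy (-1) = (-1 :: 'a poly poly)" by (simp add: const_xy_def one_pCons)
    ultimately show ?thesis using add[OF that(1), of "- g"] by simp
  qed
qed

lemma subalgebra_eval_at:
  assumes "subalgebra_xy A" "f \<in> A"
  shows "eval_at f r \<in> A"
  by (induction r) (use assms subalgebra_const[of A 0] in
      \<open>auto intro: subalgebra_add subalgebra_mult subalgebra_const\<close>)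

lemma subalgebra_eq_UNIV:
  assumes A: "subalgebra_xy A" and "var_x \<in> A" "var_y \<in> A"
  shows "A = UNIV"
proof -
  have sum: "sum F I \<in> A" if "\<And>i. i \<in> I \<Longrightarrow> F i \<in> A" for I :: "nat set" and F
    using that subalgebra_const[OF A, of 0]
    by (induction I rule: infinite_finite_induct) (auto intro: subalgebra_add[OF A])
  have pow: "f ^ n \<in> A" if "f \<in> A" for f n
    using that subalgebra_const[OF A, of 1]
    by (induction n) (auto intro: subalgebra_mult[OF A] simp: const_xy_def one_pCons)
  have "f \<in> A" for f
    by (subst poly_xy_expansion[of f])
       (intro sum subalgebra_mult[OF A] pow subalgebra_const[OF A] assms)
  then show ?thesis by blast
qed

lemma subalgebra_scale_cancel:
  fixes c :: "'a::field"
  assumes "const_xy c * f \<in> A" "subalgebra_xy A" "c \<noteq> 0"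
  shows "f \<in> A"
proof -
  have "const_xy (inverse c) * (const_xy c * f) \<in> A"
    using assms by (simp add: subalgebra_xy_def)
  then show ?thesis using assms(3) by (simp add: const_xy_def flip: one_pCons)
qed

section \<open>The shear taking a slanted line to the axis\<close>

text \<open>
  The automorphism \<open>y \<mapsto> y + t x\<close> of \<open>K[x,y]\<close>: it maps \<open>y - t x\<close> to \<open>y\<close>, so polynomials
  that vanish on the line \<open>y = t x\<close> become polynomials that vanish on the axis \<open>y = 0\<close>.
\<close>

definition shear :: "'a::comm_ring_1 \<Rightarrow> 'a poly poly \<Rightarrow> 'a poly poly"
  where "shear t f = f \<circ>\<^sub>p [:[:0, t:], 1:]"

lemma shear_add: "shear t (f + g) = shear t f + shear t g"
  by (simp add: shear_def pcompose_add)

lemma shear_mult: "shear t (f * g) = shear t f * shear t g"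
  by (simp add: shear_def pcompose_mult)

lemma shear_const [simp]: "shear t (const_xy c) = const_xy c"
  by (simp add: shear_def const_xy_def)

lemma shear_var_x [simp]: "shear t var_x = var_x"
  by (simp add: shear_def var_x_def)

lemma shear_inverse: "shear (-t) (shear t f) = f"
proof -
  have "[:[:0, t:], 1:] \<circ>\<^sub>p [:[:0, -t:], 1:] = [:0, 1:]"
    by (simp add: pcompose_pCons)
  then show ?thesis
    unfolding shear_def by (metis pcompose_assoc pcompose_idR)
qed

lemma shear_eval_at: "shear t (eval_at f r) = eval_at (shear t f) r"
  by (induction r) (use shear_const[of t 0] in \<open>simp_all add: shear_add shear_mult\<close>)

lemma partial_y_shear: "partial_y (shear t f) = shear t (partial_y f)"
  by (simp add: partial_y_def shear_def pderiv_pcompose pderiv_pCons)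

lemma partial_x_shear:
  "partial_x (shear t f) = shear t (partial_x f) + const_xy t * shear t (partial_y f)"
proof (induction f)
  case 0
  then show ?case by (simp add: shear_def partial_x_def partial_y_def)
next
  case (pCons c f)
  have "partial_x [:c:] = [:pderiv c:]" for c :: "'a poly"
    by (rule poly_eqI) (simp add: partial_x_def coeff_map_poly coeff_pCons split: nat.split)
  moreover have "partial_x [:[:0, t:], 1:] = const_xy t"
    by (rule poly_eqI)
      (simp add: partial_x_def const_xy_def coeff_map_poly coeff_pCons pderiv_pCons split: nat.split)
  moreover have "shear t (pCons c f) = [:c:] + [:[:0, t:], 1:] * shear t f" for c f
    by (simp add: shear_def pcompose_pCons)
  moreover have "partial_x (pCons c f) = pCons (pderiv c) (partial_x f)"
    by (rule poly_eqI) (simp add: partial_x_def coeff_map_poly coeff_pCons split: nat.split)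
  moreover have "partial_y (pCons c f) = f + pCons 0 (partial_y f)"
    by (simp add: partial_y_def pderiv_pCons)
  ultimately show ?case
    using pCons.IH by (simp only: shear_add partial_x_add partial_x_mult) (simp add: algebra_simps)
qed

text \<open>
  The Jacobian matrix of the shear has determinant \<open>1\<close>, so the chain rule adds no factor.
\<close>

lemma jacobian_det_shear: "jacobian_det (shear t p) (shear t q) = shear t (jacobian_det p q)"
proof -
  have "shear t (f - g) = shear t f - shear t g" for f g :: "'a poly poly"
    by (simp add: shear_def pcompose_diff)
  then have "shear t (jacobian_det p q) = shear t (partial_x p) * shear t (partial_y q)
      - shear t (partial_y p) * shear t (partial_x q)"
    by (simp only: jacobian_det_def shear_mult)
  then show ?thesis
    by (simp add: jacobian_det_def partial_x_shear partial_y_shear algebra_simps)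
qed

section \<open>Jacobian pairs with a component vanishing on a line\<close>

lemma poly_xy_eqI: "(\<And>i j. coeff_xy f i j = coeff_xy g i j) \<Longrightarrow> f = g"
  by (intro poly_eqI)

lemma eval_at_var_x: "eval_at var_x r = [:r:]"
  by (induction r) (simp_all add: var_x_def const_xy_def)

lemma eval_at_var_y: "eval_at var_y r = map_poly (\<lambda>c. [:c:]) r"
  by (induction r) (auto simp: var_y_def const_xy_def map_poly_pCons)

text \<open>
  After the shear the line is the axis, so \<open>q\<close> becomes a multiple of \<open>y\<close> and \<open>p\<close> becomes \<open>a x + r(y)\<close>.
  Shearing back, \<open>q\<close> gives the linear form, and subtracting \<open>r\<close> of that form from \<open>p\<close> gives \<open>x\<close>.
\<close>

lemma subalgebra_eq_UNIV_if_slanted_line_dvd: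
  fixes p q :: "'a::field_char_0 poly poly"
  assumes det: "jacobian_det p q = const_xy k" "k \<noteq> 0"
    and dvd: "[:[:0, -t:], 1:] dvd q"
    and A: "subalgebra_xy A" "p \<in> A" "q \<in> A"
  shows "A = UNIV"
proof -
  let ?line = "[:[:0, -t:], 1:] :: 'a poly poly"
  let ?P = "shear t p" and ?Q = "shear t q"
  have line: "shear t ?line = var_y" and unline: "shear (-t) var_y = ?line"
    by (simp_all add: shear_def var_y_def pcompose_pCons)
  have "jacobian_det ?P ?Q = const_xy k" by (simp add: jacobian_det_shear det)
  then have bracket: "bracket_coeff (coeff_xy ?P) (coeff_xy ?Q) m n = (if m = 1 \<and> n = 1 then k else 0)"
    for m n by (rule bracket_coeff_jacobian)
  obtain w where "q = ?line * w" using dvd by blast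
  then have "?Q = var_y * shear t w" by (simp only: shear_mult line)
  then have axis: "coeff_xy ?Q i 0 = 0" for i by (simp add: var_y_def)
  note tri = triangular_if_vanishing_on_axis[OF finite_support_xy finite_support_xy axis bracket det(2)]
  have "?Q = const_xy (coeff_xy ?Q 0 1) * var_y"
    by (rule poly_xy_eqI) (use tri(2) in \<open>auto simp: const_xy_def var_y_def coeff_pCons split: nat.split\<close>)
  then have "shear (-t) ?Q = const_xy (coeff_xy ?Q 0 1) * ?line"
    by (metis shear_mult shear_const unline)
  then have "const_xy (coeff_xy ?Q 0 1) * ?line \<in> A" using A(3) by (simp only: shear_inverse)
  then have line_A: "?line \<in> A" using A(1) tri(4) by (rule subalgebra_scale_cancel)
  define r where "r = map_poly (\<lambda>c. coeff c 0) ?P"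
  have "?P = const_xy (coeff_xy ?P 1 0) * var_x + eval_at var_y r"
    by (rule poly_xy_eqI)
       (use tri(1) in \<open>auto simp: eval_at_var_y const_xy_def var_x_def r_def coeff_map_poly coeff_pCons
          split: nat.split\<close>)
  then have "shear (-t) ?P = const_xy (coeff_xy ?P 1 0) * var_x + eval_at ?line r"
    by (metis shear_add shear_mult shear_const shear_var_x shear_eval_at unline)
  then have "const_xy (coeff_xy ?P 1 0) * var_x = p - eval_at ?line r"
    by (metis shear_inverse add_diff_cancel_right')
  then have "const_xy (coeff_xy ?P 1 0) * var_x \<in> A"
    using A line_A by (metis subalgebra_diff subalgebra_eval_at)
  then have x: "var_x \<in> A" using A(1) tri(3) by (rule subalgebra_scale_cancel)
  have "var_y = ?line + const_xy t * var_x"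
    by (simp add: var_x_def var_y_def const_xy_def)
  then have "var_y \<in> A"
    using A(1) line_A x by (metis subalgebra_add subalgebra_mult subalgebra_const)
  with A(1) x show ?thesis by (rule subalgebra_eq_UNIV)
qed

text \<open>
  No shear reaches the line \<open>x = 0\<close>; instead the roles of the variables and of \<open>p\<close> and \<open>q\<close> are
  exchanged, which the bracket coefficients express by transposed indices.
\<close>

lemma subalgebra_eq_UNIV_if_var_x_dvd:
  fixes p q :: "'a::field_char_0 poly poly"
  assumes det: "jacobian_det p q = const_xy k" "k \<noteq> 0"
    and dvd: "var_x dvd p"
    and A: "subalgebra_xy A" "p \<in> A" "q \<in> A"
  shows "A = UNIV"
proof -
  let ?u = "\<lambda>i j. coeff_xy q j i" and ?v = "\<lambda>i j. coeff_xy p j i"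
  have bracket: "bracket_coeff ?u ?v m n = (if m = 1 \<and> n = 1 then k else 0)" for m n
    using bracket_coeff_transpose[where u = "coeff_xy p" and v = "coeff_xy q"]
      bracket_coeff_jacobian[OF det(1)] by simp
  have fin: "finite {(i, j). coeff_xy f j i \<noteq> 0}" for f :: "'a poly poly"
    using finite_imageI[OF finite_support_xy[of f], of prod.swap]
    by (rule finite_subset[rotated]) (force simp: image_iff)
  obtain w where "p = var_x * w" using dvd by blast
  then have axis: "coeff_xy p 0 i = 0" for i by (simp add: var_x_def)
  note tri = triangular_if_vanishing_on_axis[OF fin fin axis bracket det(2)]
  have "p = const_xy (coeff_xy p 1 0) * var_x"
    by (rule poly_xy_eqI) (use tri(2) in \<open>auto simp: const_xy_def var_x_def coeff_pCons split: nat.split\<close>)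
  then have x: "var_x \<in> A" using A tri(4) by (metis subalgebra_scale_cancel)
  have "q = const_xy (coeff_xy q 0 1) * var_y + [:coeff q 0:]"
    by (rule poly_xy_eqI) (use tri(1) in \<open>auto simp: const_xy_def var_y_def coeff_pCons split: nat.split\<close>)
  then have "const_xy (coeff_xy q 0 1) * var_y = q - eval_at var_x (coeff q 0)"
    by (simp add: eval_at_var_x algebra_simps)
  then have "const_xy (coeff_xy q 0 1) * var_y \<in> A"
    using A x by (metis subalgebra_diff subalgebra_eval_at)
  then have "var_y \<in> A" using A(1) tri(3) by (rule subalgebra_scale_cancel)
  with A(1) x show ?thesis by (rule subalgebra_eq_UNIV)
qed

section \<open>Reduction to a linear factor\<close>

text \<open>
  Dehomogenise by \<open>x = 1\<close>: a root \<open>t\<close> of the resulting polynomial in \<open>y\<close> gives the factor \<open>y - t x\<close>.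
  There is no root exactly when \<open>h\<close> does not involve \<open>y\<close>, and then \<open>h\<close> is a multiple of a positive
  power of \<open>x\<close>.
\<close>

lemma homogeneous_linear_factor:
  fixes h :: "'a::alg_closed_field poly poly"
  assumes "homogeneous_xy h" "h \<notin> range const_xy"
  shows "var_x dvd h \<or> (\<exists>t. [:[:0, -t:], 1:] dvd h)"
proof -
  obtain d where d: "\<And>i j. coeff_xy h i j \<noteq> 0 \<Longrightarrow> i + j = d"
    using assms(1) unfolding homogeneous_xy_def by auto
  have "h \<noteq> 0" using assms(2) by (metis const_xy_0 rangeI)
  define a where "a j = coeff_xy h (d - j) j" for j
  have monom: "coeff h j = monom (a j) (d - j)" for j
  proof (rule poly_eqI)
    fix i
    show "coeff (coeff h j) i = coeff (monom (a j) (d - j)) i"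
      using d[of j i] by (cases "coeff_xy h i j = 0") (auto simp: a_def)
  qed
  show ?thesis
  proof (cases "degree h = 0")
    case True
    then obtain c where c: "h = [:c:]" by (metis degree_eq_zeroE)
    have "c = monom (a 0) d" using monom[of 0] c by simp
    moreover have "d \<noteq> 0"
    proof
      assume "d = 0"
      with \<open>c = monom (a 0) d\<close> c have "h = const_xy (a 0)" by (simp add: const_xy_def monom_0)
      with assms(2) show False by blast
    qed
    then obtain e where "d = Suc e" by (cases d) auto
    ultimately have "h = var_x * [:monom (a 0) e:]"
      by (simp add: c var_x_def monom_altdef)
    then show ?thesis by (metis dvd_triv_left)
  next
    case False
    define r where "r = map_poly (\<lambda>c. poly c 1) h"
    have coeff_r: "coeff r j = a j" for j
      by (simp add: r_def coeff_map_poly monom poly_monom)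
    have "a (degree h) \<noteq> 0"
      using \<open>h \<noteq> 0\<close> monom[of "degree h"] by (metis leading_coeff_0_iff monom_eq_0)
    then have "degree r \<ge> degree h" by (intro le_degree) (simp add: coeff_r)
    moreover have "degree r \<le> degree h" by (intro degree_le) (simp add: r_def coeff_map_poly coeff_eq_0)
    ultimately have deg: "degree r = degree h" by simp
    with False obtain t where t: "poly r t = 0"
      using alg_closed_imp_poly_has_root[of r] by auto
    have "coeff h j * [:0, t:] ^ j = monom (a j * t ^ j) d" for j
    proof (cases "a j = 0")
      case True
      then show ?thesis by (simp add: monom)
    next
      case False
      then have "d - j + j = d" using d[of j "d - j"] by (simp add: a_def)
      moreover have "[:0, t:] = monom t 1" by (simp add: monom_altdef)
      ultimately show ?thesis by (simp only: monom mult_monom monom_power mult_1)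
    qed
    then have "poly h [:0, t:] = (\<Sum>j\<le>degree h. monom (a j * t ^ j) d)"
      by (simp add: poly_altdef)
    also have "\<dots> = monom (poly r t) d"
      by (simp add: poly_altdef deg coeff_r monom_sum)
    finally have "poly h [:0, t:] = 0" by (simp add: t)
    then have "[:- [:0, t:], 1:] dvd h" by (simp only: poly_eq_0_iff_dvd)
    then show ?thesis by auto
  qed
qed

lemma poly_eval_at: "poly (eval_at f r) z = r \<circ>\<^sub>p poly f z"
  by (induction r) (simp_all add: const_xy_def pcompose_pCons)

theorem corollary3p1:
  fixes p q g h :: "'a::{alg_closed_field, field_char_0} poly poly"
  assumes "jacobian_pair p q"
    and "p = var_x + g"
    and "homogeneous_xy h"
    and "h \<notin> range const_xy"
    and "h dvd g"
  shows "generated_subalgebra {p, q} = UNIV"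
proof -
  let ?A = "generated_subalgebra {p, q}"
  have A: "subalgebra_xy ?A" by (rule subalgebra_generated)
  have pq: "p \<in> ?A" "q \<in> ?A"
    unfolding generated_subalgebra_def by (simp_all add: hull_inc)
  obtain k where k: "k \<noteq> 0" "jacobian_det p q = const_xy k"
    using assms(1) by (rule jacobian_pair_imp_det_const)
  from homogeneous_linear_factor[OF assms(3,4)] show ?thesis
  proof
    assume "var_x dvd h"
    with assms(2,5) have "var_x dvd p" by (metis dvd_add dvd_refl dvd_trans)
    with k A pq show ?thesis by (metis subalgebra_eq_UNIV_if_var_x_dvd)
  next
    assume "\<exists>t. [:[:0, -t:], 1:] dvd h"
    then obtain t where t: "[:[:0, -t:], 1:] dvd g" using assms(5) by (metis dvd_trans)
    then have "poly g [:0, t:] = 0" by (simp add: poly_eq_0_iff_dvd)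
    then have p_line: "poly p [:0, t:] = [:0, 1:]" by (simp add: assms(2) var_x_def)
    define e where "e = eval_at p (poly q [:0, t:])"
    have "poly (q - e) [:0, t:] = 0"
      by (simp add: e_def poly_eval_at p_line pcompose_idR)
    then have "[:- [:0, t:], 1:] dvd q - e" by (simp only: poly_eq_0_iff_dvd)
    then have "[:[:0, -t:], 1:] dvd q - e" by simp
    moreover have "jacobian_det p (q - e) = const_xy k"
      using jacobian_det_add_right[of p "q - e" e] k(2) by (simp add: e_def jacobian_det_eval_at)
    moreover have "q - e \<in> ?A"
      using A pq by (auto simp: e_def intro: subalgebra_diff subalgebra_eval_at)
    ultimately show ?thesis
      using k(1) A pq(1) by (metis subalgebra_eq_UNIV_if_slanted_line_dvd)
  qed
qed

end
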